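(* Let $f=\prod_{i=1}^r q_i$ with $q_i=p_i^{e_i}$ powers of distinct primes $p_i$, let $\mathbf{K}=\mathbf{Q}(\zeta_f)$, $G=(\mathbf{Z}/f\mathbf{Z})^\times/\{-1,1\}$, and let $\mathcal{Q}$ be the set of the $2^r$ products of subsets of $\{q_1,\dots,q_r\}$. Let $e\in\mathcal{Q}$ with $e\neq f$, and let $\chi$ be an even Dirichlet character modulo $f$ whose conductor $c$ satisfies $c>1$ (so $c\mid f$). If $\gcd(c,e)=1$ then \[ |\chi(\mathrm{Log}(\zeta_f^e-1))|=\frac{\varphi(e)\sqrt c}{2\ln 2}\left(\prod_{i:\ p_i\mid f/e}|1-\chi(p_i)|\right)|L(1,\chi)|, \] and otherwise $\chi(\mathrm{Log}(\zeta_f^e-1))=0$.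
   Context: $\mathrm{Log}(x)\in\mathbf{R}[G]$ is $\sum_{\alpha\in G}\log|\sigma_\alpha(x)|\,\alpha$, where $\sigma_\alpha(\zeta_f)=\zeta_f^\alpha$ and $\log$ is the binary logarithm. An even character $\chi$ is extended linearly to $\mathbf{R}[G]$ by $\chi(\sum_\alpha y_\alpha\alpha)=\sum_\alpha y_\alpha\chi(\alpha)$. In $\chi(p_i)$, $\chi$ denotes the associated primitive character modulo its conductor $c$ (so $\chi(p_i)=0$ when $p_i\mid c$). $L(1,\chi)$ is the Dirichlet $L$-function at $1$, and $\ln$ is the natural logarithm. *)

theory Defs
  imports "HOL-Analysis.Analysis" "HOL-Number_Theory.Number_Theory"
    "HOL-Computational_Algebra.Polynomial"
begin

definition dirichlet_char :: "nat \<Rightarrow> (nat \<Rightarrow> complex) \<Rightarrow> bool" where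
  "dirichlet_char f chi \<longleftrightarrow> f > 0 \<and> (\<forall>n. chi (n + f) = chi n) \<and>
     (\<forall>m n. chi (m * n) = chi m * chi n) \<and> chi 1 = 1 \<and>
     (\<forall>n. chi n \<noteq> 0 \<longleftrightarrow> coprime n f)"

(* even character: chi(-1) = 1, where -1 is represented by f - 1 *)
definition even_char :: "nat \<Rightarrow> (nat \<Rightarrow> complex) \<Rightarrow> bool" where
  "even_char f chi \<longleftrightarrow> chi (f - 1) = 1"

definition induced_modulus :: "nat \<Rightarrow> (nat \<Rightarrow> complex) \<Rightarrow> nat \<Rightarrow> bool" where
  "induced_modulus f chi d \<longleftrightarrow> d dvd f \<and>
     (\<forall>a. coprime a f \<and> [a = 1] (mod d) \<longrightarrow> chi a = 1)"

definition conductor :: "nat \<Rightarrow> (nat \<Rightarrow> complex) \<Rightarrow> nat" where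
  "conductor f chi = (LEAST d. d > 0 \<and> induced_modulus f chi d)"

definition prim_char :: "nat \<Rightarrow> (nat \<Rightarrow> complex) \<Rightarrow> nat \<Rightarrow> complex" where
  "prim_char f chi n =
     (let c = conductor f chi in
      if coprime n c then chi (SOME m. coprime m f \<and> [m = n] (mod c)) else 0)"

definition L1 :: "(nat \<Rightarrow> complex) \<Rightarrow> complex" where
  "L1 \<psi> = (\<Sum>n. \<psi> (Suc n) / of_nat (Suc n))"

definition zeta :: "nat \<Rightarrow> complex" where
  "zeta f = cis (2 * pi / real f)"

(* G = (Z/fZ)^* / {-1,1}: classes {a, -a} of units, residues in {0..<f} *)
definition Gf :: "nat \<Rightarrow> nat set set" where
  "Gf f = (\<lambda>a. {a, (f - a) mod f}) ` {a. a < f \<and> coprime a f}"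

definition rep :: "nat set \<Rightarrow> nat" where
  "rep C = (SOME a. a \<in> C)"

(* sigma_a acting on an element of Q(zeta_f) written as p(zeta_f), p a rational polynomial *)
definition sigma :: "nat \<Rightarrow> nat \<Rightarrow> rat poly \<Rightarrow> complex" where
  "sigma f a p = poly (map_poly of_rat p) (zeta f ^ a)"

(* Log(x) in R[G], as coefficient function G \<Rightarrow> real; binary logarithm *)
definition Log_vec :: "nat \<Rightarrow> rat poly \<Rightarrow> nat set \<Rightarrow> real" where
  "Log_vec f p C = log 2 (cmod (sigma f (rep C) p))"

(* linear extension of an even character to R[G] *)
definition char_ext :: "nat \<Rightarrow> (nat \<Rightarrow> complex) \<Rightarrow> (nat set \<Rightarrow> real) \<Rightarrow> complex" where
  "char_ext f chi y = (\<Sum>C\<in>Gf f. of_real (y C) * chi (rep C))"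

definition Qset :: "nat \<Rightarrow> nat set" where
  "Qset f = (\<lambda>S. \<Prod>p\<in>S. p ^ multiplicity p f) ` Pow (prime_factors f)"

end

(* Since e and g = f / e are coprime and zeta_f^e = zeta_g, twice the character sum is
   a sum of chi(a) log |zeta_g^a - 1| over the units a mod f.  If the conductor c is not
   coprime to e, then g is not an induced modulus, and translating by a unit a = 1 mod g with
   chi(a) <> 1 kills the sum.  Otherwise c divides g, the sum over the fibres of reduction mod g
   contributes phi(e), and what remains is T(g), where T(n) is the sum of psi(a) ln |zeta_n^a - 1|
   over the units mod n and psi is the primitive character.  The distribution relation
   prod_k (1 - zeta_p^k w) = 1 - w^p gives T(pn) = T(n) if p divides n and
   T(pn) = (1 - psi(p)) T(n) otherwise, so only T(c) is needed.  Expanding ln |1 - r zeta_c^b| in a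
   power series, summing against psi and letting r tend to 1 (Abel) yields
   T(c) = - tau(psi) * cnj (L(1, psi)), and |tau(psi)| = sqrt c. *)
theory Submission
  imports Defs
begin

section \<open>Powers of roots of unity\<close>

lemma bij_betw_zeta_powers:
  assumes "n > 0"
  shows "bij_betw (\<lambda>k. zeta n ^ k) {..<n} {z. z ^ n = 1}"
proof -
  have "zeta n ^ k = cis (2 * pi * real k / real n)" for k
    by (simp add: zeta_def Complex.DeMoivre mult_ac)
  then show ?thesis using Complex.bij_betw_roots_unity[OF assms] by simp
qed

lemma norm_zeta [simp]: "cmod (zeta n) = 1"
  by (simp add: zeta_def)

lemma zeta_power_self: "n > 0 \<Longrightarrow> zeta n ^ n = 1"
  by (simp add: zeta_def Complex.DeMoivre)

lemma zeta_mult_power: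
  assumes "m > 0" "n > 0"
  shows "zeta (m * n) ^ m = zeta n"
  using assms by (simp add: zeta_def Complex.DeMoivre mult_ac)

lemma zeta_power_cong:
  assumes "n > 0" "[a = b] (mod n)"
  shows "zeta n ^ a = zeta n ^ b"
proof -
  have "zeta n ^ a = zeta n ^ (a mod n)" for a
  proof -
    have "zeta n ^ (a div n * n + a mod n) = zeta n ^ (a mod n)"
      unfolding power_add power_mult power_mult[of _ _ n, unfolded mult.commute[of _ n]]
      using zeta_power_self[OF assms(1)] by (metis mult.commute mult_1 power_mult power_one)
    then show ?thesis by simp
  qed
  then show ?thesis using assms(2) by (metis cong_def)
qed

lemma zeta_power_eq_iff:
  assumes "n > 0"
  shows "zeta n ^ a = zeta n ^ b \<longleftrightarrow> [a = b] (mod n)"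
proof
  assume "zeta n ^ a = zeta n ^ b"
  then have "zeta n ^ (a mod n) = zeta n ^ (b mod n)"
    using zeta_power_cong[OF assms] by (metis cong_mod_left cong_refl)
  then have "a mod n = b mod n"
    using bij_betw_imp_inj_on[OF bij_betw_zeta_powers[OF assms]] assms
    by (auto simp: inj_on_def)
  then show "[a = b] (mod n)" by (simp add: cong_def)
qed (use zeta_power_cong[OF assms] in blast)

lemma zeta_power_eq_1_iff: "n > 0 \<Longrightarrow> zeta n ^ a = 1 \<longleftrightarrow> n dvd a"
  using zeta_power_eq_iff[of n a 0] by (simp add: cong_0_iff)

text \<open>As polynomials in \<open>w\<close> both sides have degree at most \<open>n\<close>, and
  they agree at 0 and at the \<open>n\<close> roots of unity, hence everywhere.\<close>

lemma prod_one_minus_zeta: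
  assumes "n > 0"
  shows "(\<Prod>k<n. 1 - zeta n ^ k * w) = 1 - w ^ n"
proof -
  define P where "P = (\<Prod>k<n. [:1, - (zeta n ^ k):])"
  define Q where "Q = 1 - Polynomial.monom (1::complex) n"
  let ?A = "insert 0 {z::complex. z ^ n = 1}"
  have card: "card ?A = Suc n"
    using assms by (simp add: card_roots_unity_eq finite_roots_unity power_0_left)
  have "degree P \<le> (\<Sum>k<n. degree [:1, - (zeta n ^ k):])"
    unfolding P_def by (rule order.trans[OF degree_prod_sum_le]) auto
  also have "\<dots> \<le> (\<Sum>k<n. 1)"
    by (intro sum_mono) (rule order.trans[OF degree_pCons_le], simp)
  finally have "degree P \<le> (\<Sum>k<n. 1)" .
  then have "degree P < card ?A" using card by simp
  moreover have "degree Q \<le> n"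
    unfolding Q_def by (intro degree_diff_le) (auto simp: degree_monom_le)
  then have "degree Q < card ?A" using card by simp
  moreover have "poly P z = poly Q z" if "z \<in> ?A" for z
  proof (cases "z = 0")
    case True
    then show ?thesis using assms by (simp add: P_def Q_def poly_prod poly_monom)
  next
    case False
    then have z: "z ^ n = 1" using that by simp
    then have "(1 / z) ^ n = 1" by (simp add: power_divide)
    then obtain k where k: "k < n" "1 / z = zeta n ^ k"
      using bij_betw_imp_surj_on[OF bij_betw_zeta_powers[OF assms]] by blast
    then have "z * zeta n ^ k = 1" using False by (metis nonzero_eq_divide_eq mult.commute)
    then have "poly P z = 0" unfolding P_def poly_prod using k(1) by auto
    then show ?thesis using z by (simp add: Q_def poly_monom)
  qed
  ultimately have "P = Q" by (intro poly_eqI_degree[of ?A]) auto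
  then have "poly P w = poly Q w" by simp
  then show ?thesis by (simp add: P_def Q_def poly_prod poly_monom mult_ac)
qed

section \<open>Abel's limit theorem for harmonic weights\<close>

lemma sum_by_parts_lessThan:
  fixes a b :: "nat \<Rightarrow> complex"
  shows "(\<Sum>k<N. a k * b k) =
    (\<Sum>k<N. a k) * b N + (\<Sum>k<N. (\<Sum>j\<le>k. a j) * (b k - b (Suc k)))"
  by (induction N) (simp_all add: algebra_simps lessThan_Suc_atMost[symmetric])

text \<open>The second bound is the gap at \<open>r = 1\<close>: it majorises the gaps uniformly in \<open>r\<close> and is summable
  by telescoping.\<close>

lemma power_gap_bounds:
  fixes r :: real
  assumes "0 \<le> r" "r \<le> 1"
  shows "0 \<le> r ^ Suc k / real (Suc k) - r ^ Suc (Suc k) / real (Suc (Suc k))"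
    and "r ^ Suc k / real (Suc k) - r ^ Suc (Suc k) / real (Suc (Suc k)) \<le>
      1 / real (Suc k) - 1 / real (Suc (Suc k))"
proof -
  have "r ^ Suc (Suc k) \<le> r ^ Suc k" using assms by (intro power_decreasing) auto
  then have "r ^ Suc (Suc k) / real (Suc (Suc k)) \<le> r ^ Suc k / real (Suc k)"
    using assms by (intro frac_le) auto
  then show "0 \<le> r ^ Suc k / real (Suc k) - r ^ Suc (Suc k) / real (Suc (Suc k))" by simp
next
  \<comment> \<open>The second bound cleared of denominators. Passing from \<open>k\<close> to
    \<open>k + 1\<close> lowers the left side by
    \<open>(k + 2) * r ^ Suc k * (1 - r)\<^sup>2\<close>.\<close>
  have *: "real (k + 2) * r ^ Suc k - real (k + 1) * r ^ Suc (Suc k) \<le> 1"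
  proof (induction k)
    case 0
    have "0 \<le> (1 - r)\<^sup>2" by simp
    then show ?case by (simp add: power2_eq_square algebra_simps)
  next
    case (Suc k)
    have "0 \<le> real (k + 2) * r ^ Suc k * (1 - r)\<^sup>2" using assms by simp
    then show ?case using Suc by (simp add: power2_eq_square algebra_simps)
  qed
  then show "r ^ Suc k / real (Suc k) - r ^ Suc (Suc k) / real (Suc (Suc k)) \<le>
      1 / real (Suc k) - 1 / real (Suc (Suc k))"
    by (simp add: divide_simps) (simp add: algebra_simps)
qed

text \<open>Summation by parts rewrites the series as a sum of the terms \<open>g k r\<close>,
  dominated by the telescoping \<open>d k\<close> uniformly for \<open>r\<close> between 0 and 1
  inclusive. The Weierstrass test then gives continuity up to \<open>r = 1\<close>.\<close>

lemma abel_harmonic: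
  fixes a :: "nat \<Rightarrow> complex"
  assumes bound: "\<And>N. cmod (\<Sum>k<N. a k) \<le> M"
  shows "summable (\<lambda>k. a k / of_nat (Suc k))"
    and "((\<lambda>r. \<Sum>k. a k * of_real (r ^ Suc k / real (Suc k))) \<longlongrightarrow>
      (\<Sum>k. a k / of_nat (Suc k))) (at_left 1)"
proof -
  define b where "b = (\<lambda>r k. complex_of_real (r ^ Suc k / real (Suc k)))"
  define g where "g = (\<lambda>k r. (\<Sum>j\<le>k. a j) * (b r k - b r (Suc k)))"
  define d where "d = (\<lambda>k. M * (1 / real (Suc k) - 1 / real (Suc (Suc k))))"
  have M0: "0 \<le> M" using bound[of 0] by simp
  have lim0: "(\<lambda>k. 1 / real (Suc k)) \<longlonglongrightarrow> 0"
    using LIMSEQ_inverse_real_of_nat by (simp add: inverse_eq_divide)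
  have "summable d"
    unfolding d_def by (intro summable_mult telescope_summable'[OF lim0])
  have g_le: "norm (g k r) \<le> d k" if "r \<in> {0..1}" for k r
  proof -
    have "norm (b r k - b r (Suc k)) =
      \<bar>r ^ Suc k / real (Suc k) - r ^ Suc (Suc k) / real (Suc (Suc k))\<bar>"
      unfolding b_def of_real_diff[symmetric] norm_of_real by (rule refl)
    also have "\<dots> \<le> 1 / real (Suc k) - 1 / real (Suc (Suc k))"
      using power_gap_bounds[of r k] that by auto
    finally show ?thesis
      unfolding g_def d_def norm_mult
      using bound[of "Suc k"] M0 by (intro mult_mono) (auto simp: lessThan_Suc_atMost)
  qed
  have sums: "(\<lambda>k. a k * b r k) sums (\<Sum>k. g k r)" if r: "r \<in> {0..1}" for r
  proof -
    have "summable (\<lambda>k. g k r)"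
      by (rule summable_comparison_test'[OF \<open>summable d\<close>]) (use g_le r in auto)
    then have "(\<lambda>k. g k r) sums (\<Sum>k. g k r)" by (rule summable_sums)
    \<comment> \<open>The boundary term dies: bounded partial sums times a weight of at most
      \<open>1 / real (Suc N)\<close>.\<close>
    moreover have "(\<lambda>N. (\<Sum>k<N. a k) * b r N) \<longlonglongrightarrow> 0"
    proof (rule Lim_null_comparison)
      have "norm ((\<Sum>k<N. a k) * b r N) \<le> M * (1 / real (Suc N))" for N
      proof -
        have "norm (b r N) \<le> 1 / real (Suc N)"
          unfolding b_def norm_of_real using r by (auto simp: abs_mult power_le_one mult_le_one divide_right_mono)
        then show ?thesis unfolding norm_mult using bound[of N] M0 by (intro mult_mono) auto
      qed
      then show "\<forall>\<^sub>F N in sequentially. norm ((\<Sum>k<N. a k) * b r N) \<le> M * (1 / real (Suc N))"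
        by simp
      show "(\<lambda>N. M * (1 / real (Suc N))) \<longlonglongrightarrow> 0"
        using tendsto_mult[OF tendsto_const[of M] lim0] by simp
    qed
    ultimately have "(\<lambda>N. (\<Sum>k<N. a k) * b r N + (\<Sum>k<N. g k r)) \<longlonglongrightarrow> 0 + (\<Sum>k. g k r)"
      unfolding sums_def by (intro tendsto_add)
    then show ?thesis
      unfolding sums_def g_def sum_by_parts_lessThan[of a "b r"] by simp
  qed
  have b1: "a k * b 1 k = a k / of_nat (Suc k)" for k
    by (simp add: b_def)
  have sums1: "(\<lambda>k. a k / of_nat (Suc k)) sums (\<Sum>k. g k 1)"
    using sums[of 1] unfolding b1 by simp
  then show "summable (\<lambda>k. a k / of_nat (Suc k))" by (rule sums_summable)
  have "uniform_limit {0..1} (\<lambda>n r. \<Sum>k<n. g k r) (\<lambda>r. \<Sum>k. g k r) sequentially"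
    by (rule Weierstrass_m_test[OF g_le \<open>summable d\<close>])
  then have "continuous_on {0..1} (\<lambda>r. \<Sum>k. g k r)"
    by (rule uniform_limit_theorem[rotated])
       (auto simp: g_def b_def simp del: of_nat_Suc of_real_divide of_real_power intro!: always_eventually continuous_intros)
  then have "((\<lambda>r. \<Sum>k. g k r) \<longlongrightarrow> (\<Sum>k. g k 1)) (at 1 within {0..1})"
    by (auto simp: continuous_on)
  then have "((\<lambda>r. \<Sum>k. g k r) \<longlongrightarrow> (\<Sum>k. g k 1)) (at_left 1)"
    by (simp add: at_within_Icc_at_left)
  then have "((\<lambda>r. \<Sum>k. g k r) \<longlongrightarrow> (\<Sum>k. a k / of_nat (Suc k))) (at_left 1)"
    using sums1 by (simp add: sums_iff)
  moreover have "\<forall>\<^sub>F r in at_left (1::real). (\<Sum>k. g k r) = (\<Sum>k. a k * b r k)"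
    by (intro eventually_mono[OF eventually_at_left_real[of 0 1]])
       (use sums in \<open>auto simp: sums_iff\<close>)
  ultimately show "((\<lambda>r. \<Sum>k. a k * of_real (r ^ Suc k / real (Suc k))) \<longlongrightarrow>
      (\<Sum>k. a k / of_nat (Suc k))) (at_left 1)"
    unfolding b_def by (rule Lim_transform_eventually)
qed

section \<open>Gauss sums and the value at 1\<close>

abbreviation units :: "nat \<Rightarrow> nat set" where
  "units n \<equiv> {a. a < n \<and> coprime a n}"

lemma units_eq_totatives: "n > 1 \<Longrightarrow> units n = totatives n"
  by (auto simp: totatives_def order_le_less intro: Nat.gr0I)

lemma card_units: "n > 1 \<Longrightarrow> card (units n) = totient n"
  by (simp add: units_eq_totatives totient_def)

lemma bij_betw_mult_units:
  assumes "n > 0" "coprime u n"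
  shows "bij_betw (\<lambda>a. a * u mod n) (units n) (units n)"
proof -
  have "inj_on (\<lambda>a. a * u mod n) (units n)"
  proof (rule inj_onI)
    fix a b assume ab: "a \<in> units n" "b \<in> units n" "a * u mod n = b * u mod n"
    then have "[a * u = b * u] (mod n)" by (simp add: cong_def)
    then have "[a = b] (mod n)" using assms(2) by (simp add: cong_mult_rcancel_nat)
    then show "a = b" using ab by (simp add: cong_def)
  qed
  moreover have "(\<lambda>a. a * u mod n) ` units n \<subseteq> units n"
    using assms by auto
  ultimately show ?thesis
    using endo_inj_surj[of "units n"] by (simp add: bij_betw_def)
qed

lemma sum_units_mult:
  assumes "n > 0" "coprime u n" "\<And>a. G (a mod n) = G a"
  shows "(\<Sum>a\<in>units n. G (a * u)) = (\<Sum>a\<in>units n. G a)"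
  using sum.reindex_bij_betw[OF bij_betw_mult_units[OF assms(1,2)], of G] assms(3) by simp

text \<open>The modulus stays a parameter because the theory is applied twice: to a character modulo
  \<open>f\<close> and to its primitive character modulo the conductor.\<close>

locale dchar =
  fixes c :: nat and chi :: "nat \<Rightarrow> complex"
  assumes dirichlet_char: "dirichlet_char c chi"
begin

lemma modulus_pos: "c > 0"
  and chi_add: "chi (a + c) = chi a"
  and chi_mult: "chi (a * b) = chi a * chi b"
  and chi_1: "chi (Suc 0) = 1"
  and chi_eq_0_iff: "chi a = 0 \<longleftrightarrow> \<not> coprime a c"
  using dirichlet_char by (auto simp: dirichlet_char_def)

lemma chi_mod: "chi (a mod c) = chi a"
proof -
  have "chi (a mod c + k * c) = chi (a mod c)" for k
  proof (induction k)
    case (Suc k)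
    then show ?case using chi_add[of "a mod c + k * c"] by (simp add: ac_simps)
  qed simp
  then show ?thesis by (metis mod_div_mult_eq)
qed

lemma chi_cong: "[a = b] (mod c) \<Longrightarrow> chi a = chi b"
  by (metis chi_mod cong_def)

lemma chi_power: "chi (a ^ k) = chi a ^ k"
  using chi_1 by (induction k) (simp_all add: chi_mult)

lemma norm_chi: "coprime a c \<Longrightarrow> cmod (chi a) = 1"
proof -
  assume "coprime a c"
  then have "chi (a ^ totient c) = 1"
    using chi_cong[OF euler_theorem] chi_1 by simp
  then have "chi a ^ totient c = 1" by (simp add: chi_power)
  moreover have "totient c > 0" using modulus_pos by simp
  ultimately show ?thesis using power_eq_1_iff by force
qed

lemma chi_mult_cnj: "coprime a c \<Longrightarrow> chi a * cnj (chi a) = 1"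
  by (simp add: complex_norm_square[symmetric] norm_chi)

text \<open>Reindexing by the unit \<open>u\<close> pulls out \<open>chi u\<close>. This yields both
  the transformation rule of Gauss sums and the vanishing of a sum whose \<open>G\<close> is
  invariant under some \<open>u\<close> with \<open>chi u \<noteq> 1\<close>.\<close>

lemma sum_units_chi_mult:
  assumes "coprime u c" "\<And>a. G (a mod c) = G a"
  shows "(\<Sum>a\<in>units c. chi a * G a) = chi u * (\<Sum>a\<in>units c. chi a * G (a * u))"
proof -
  have "(\<Sum>a\<in>units c. chi a * G a) = (\<Sum>a\<in>units c. chi (a * u) * G (a * u))"
    using sum_units_mult[OF modulus_pos assms(1), of "\<lambda>a. chi a * G a"] assms(2)
    by (simp add: chi_mod)
  then show ?thesis by (simp add: chi_mult sum_distrib_left mult_ac)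
qed

end

section \<open>Gauss sums of an even primitive character\<close>

locale primitive_even_char = dchar +
  assumes modulus_gt_1: "c > 1"
    and even_char: "even_char c chi"
    and primitive: "d dvd c \<Longrightarrow> d < c \<Longrightarrow> \<exists>a. coprime a c \<and> [a = 1] (mod d) \<and> chi a \<noteq> 1"
begin

text \<open>The Gauss sum twisted by \<open>n\<close>; \<open>gauss 1\<close> is the usual
  tau(chi).\<close>

definition gauss :: "nat \<Rightarrow> complex" where
  "gauss n = (\<Sum>b\<in>units c. chi b * zeta c ^ (b * n))"

lemma zeta_power_mod: "zeta c ^ (a mod c * n) = zeta c ^ (a * n)"
  using modulus_pos by (intro zeta_power_cong) (auto simp: cong_def mod_mult_left_eq)

lemma gauss_shift: "coprime u c \<Longrightarrow> gauss n = chi u * gauss (u * n)"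
  using sum_units_chi_mult[of u "\<lambda>a. zeta c ^ (a * n)"]
  by (simp add: gauss_def zeta_power_mod mult.assoc)

text \<open>Separability. If \<open>n\<close> is prime to \<open>c\<close>, a substitution suffices.
  Otherwise both sides vanish: primitivity supplies a unit \<open>a\<close> with
  \<open>chi a \<noteq> 1\<close> that fixes \<open>n\<close> modulo \<open>c\<close>.\<close>

lemma gauss_eq: "gauss n = cnj (chi n) * gauss 1"
proof (cases "coprime n c")
  case True
  have "cnj (chi n) * gauss 1 = (chi n * cnj (chi n)) * gauss n"
    using gauss_shift[OF True, of 1] by simp
  then show ?thesis using True by (simp add: chi_mult_cnj)
next
  case False
  define d where "d = gcd n c"
  have d: "d dvd n" "d dvd c" "d \<noteq> 0"
    using modulus_pos by (simp_all add: d_def)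
  have "d \<noteq> 1" using False unfolding d_def coprime_iff_gcd_eq_1 .
  from d have c: "d * (c div d) = c" "d * (n div d) = n" by simp_all
  \<comment> \<open>As \<open>d > 1\<close>, primitivity applies to the proper divisor
    \<open>c div d\<close>. An \<open>a\<close> that is 1 modulo \<open>c div d\<close> satisfies
    \<open>[a * n = n] (mod c)\<close> because \<open>d\<close> divides \<open>n\<close>.\<close>
  have "c div d < c" using d(3) \<open>d \<noteq> 1\<close> modulus_pos by (intro div_less_dividend) auto
  moreover have "c div d dvd c" using c by (metis dvd_triv_right)
  ultimately obtain a where a: "coprime a c" "[a = 1] (mod c div d)" "chi a \<noteq> 1"
    using primitive by blast
  have "[d * a = d * 1] (mod d * (c div d))"
    using a(2) by (rule cong_cmult_leftI)
  then have "[d * a * (n div d) = d * 1 * (n div d)] (mod c)"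
    unfolding c(1) by (rule cong_scalar_right)
  moreover have "d * a * (n div d) = a * n" "d * 1 * (n div d) = n"
    using c(2) by (simp_all add: mult.commute[of d] mult.assoc)
  ultimately have an: "[a * n = n] (mod c)" by simp
  have "gauss (a * n) = gauss n"
    unfolding gauss_def using modulus_pos an
    by (intro sum.cong refl arg_cong2[of _ _ _ _ "(*)"] zeta_power_cong cong_scalar_left) auto
  then have "(1 - chi a) * gauss n = 0"
    using gauss_shift[OF a(1), of n] by (simp add: algebra_simps)
  then have "gauss n = 0" using a(3) by simp
  then show ?thesis using False chi_eq_0_iff by simp
qed

text \<open>The sum is \<open>gauss 0\<close>, and \<open>chi 0 = 0\<close> because
  \<open>c > 1\<close>.\<close>

lemma sum_chi_eq_0: "(\<Sum>b\<in>units c. chi b) = 0"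
  using gauss_eq[of 0] modulus_gt_1 chi_eq_0_iff[of 0] by (simp add: gauss_def)

text \<open>Parseval: the sum of the squared norms of \<open>gauss n\<close> over a period is
  computed once by orthogonality of the exponentials and once by separability.\<close>

lemma norm_gauss: "cmod (gauss 1) = sqrt (real c)"
proof -
  let ?U = "units c"
  have card: "(\<Sum>b\<in>?U. chi b * cnj (chi b)) = of_nat (card ?U)"
    by (simp add: chi_mult_cnj)
  have ortho: "(\<Sum>n<c. zeta c ^ (a * n) * cnj (zeta c ^ (b * n))) = (if a = b then of_nat c else 0)"
    if "a < c" "b < c" for a b
  proof -
    \<comment> \<open>The summand is \<open>w ^ n\<close> for a \<open>c\<close>-th root of unity
      \<open>w\<close> that is 1 only if \<open>a = b\<close>, so the sum is geometric.\<close>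
    define w where "w = zeta c ^ a * cnj (zeta c ^ b)"
    have inv: "zeta c ^ b * cnj (zeta c ^ b) = 1"
      by (simp add: complex_norm_square[symmetric] norm_power del: complex_cnj_power)
    have "w = 1 \<longleftrightarrow> zeta c ^ a = zeta c ^ b"
    proof
      assume "w = 1"
      then have "zeta c ^ a * (zeta c ^ b * cnj (zeta c ^ b)) = zeta c ^ b"
        by (simp add: w_def algebra_simps)
      then show "zeta c ^ a = zeta c ^ b" unfolding inv by simp
    qed (use inv in \<open>simp add: w_def\<close>)
    also have "\<dots> \<longleftrightarrow> a = b"
      using that zeta_power_eq_iff[OF modulus_pos, of a b] by (auto simp: cong_def)
    finally have w1: "w = 1 \<longleftrightarrow> a = b" .
    have "w ^ c = (zeta c ^ c) ^ a * cnj ((zeta c ^ c) ^ b)"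
      unfolding w_def power_mult_distrib complex_cnj_power[symmetric] power_mult[symmetric]
      by (simp add: mult.commute)
    then have "w ^ c = 1" by (simp add: zeta_power_self modulus_pos)
    have "(\<Sum>n<c. zeta c ^ (a * n) * cnj (zeta c ^ (b * n))) = (\<Sum>n<c. w ^ n)"
      by (simp add: w_def power_mult power_mult_distrib)
    also have "\<dots> = (if a = b then of_nat c else 0)"
    proof (cases "a = b")
      case False
      then show ?thesis using w1 \<open>w ^ c = 1\<close> geometric_sum[of w c] by simp
    qed (use w1 in simp)
    finally show ?thesis .
  qed
  have "(\<Sum>n<c. gauss n * cnj (gauss n)) =
      (\<Sum>n<c. \<Sum>a\<in>?U. \<Sum>b\<in>?U. chi a * cnj (chi b) * (zeta c ^ (a * n) * cnj (zeta c ^ (b * n))))"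
    unfolding gauss_def cnj_sum sum_product by (simp add: mult_ac)
  also have "\<dots> = (\<Sum>a\<in>?U. \<Sum>b\<in>?U. \<Sum>n<c. chi a * cnj (chi b) * (zeta c ^ (a * n) * cnj (zeta c ^ (b * n))))"
    by (subst sum.swap, rule sum.cong[OF refl], rule sum.swap)
  also have "\<dots> = (\<Sum>a\<in>?U. \<Sum>b\<in>?U. chi a * cnj (chi b) * (if a = b then of_nat c else 0))"
    unfolding sum_distrib_left[symmetric] by (intro sum.cong refl) (simp add: ortho del: complex_cnj_power)
  also have "\<dots> = (\<Sum>a\<in>?U. chi a * cnj (chi a) * of_nat c)"
    by (intro sum.cong refl) (simp add: if_distrib sum.delta cong: if_cong)
  also have "\<dots> = of_nat (card ?U) * of_nat c"
    unfolding sum_distrib_right[symmetric] card ..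
  finally have 1: "(\<Sum>n<c. gauss n * cnj (gauss n)) = of_nat (card ?U) * of_nat c" .
  have "(\<Sum>n<c. gauss n * cnj (gauss n)) = gauss 1 * cnj (gauss 1) * (\<Sum>n<c. chi n * cnj (chi n))"
    by (subst (1 2) gauss_eq) (simp add: sum_distrib_left mult_ac)
  also have "(\<Sum>n<c. chi n * cnj (chi n)) = (\<Sum>n\<in>?U. chi n * cnj (chi n))"
    by (intro sum.mono_neutral_right) (auto simp: chi_eq_0_iff)
  finally have "of_nat (card ?U) * (gauss 1 * cnj (gauss 1)) = of_nat (card ?U) * (of_nat c :: complex)"
    using 1 card by (metis mult.commute)
  moreover have "card ?U \<noteq> 0" using modulus_gt_1 by (simp add: card_units)
  ultimately have "gauss 1 * cnj (gauss 1) = of_nat c"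
    by (metis mult_cancel_left of_nat_eq_0_iff)
  then have "complex_of_real ((cmod (gauss 1))\<^sup>2) = complex_of_real (real c)"
    unfolding complex_norm_square by simp
  then have "(cmod (gauss 1))\<^sup>2 = real c" by (simp only: of_real_eq_iff)
  then show ?thesis by (metis norm_ge_zero real_sqrt_unique)
qed

section \<open>Real parts, power series and the value of \<open>L1\<close>\<close>

lemma chi_minus_1: "chi (c - 1) = 1" "coprime (c - 1) c"
proof -
  show "chi (c - 1) = 1" using even_char unfolding even_char_def .
  then show "coprime (c - 1) c" using chi_eq_0_iff[of "c - 1"] by fastforce
qed

lemma cnj_zeta_power: "cnj (zeta c ^ a) = zeta c ^ ((c - 1) * a)"
proof -
  have "zeta c ^ a * zeta c ^ ((c - 1) * a) = zeta c ^ (c * a)"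
    using modulus_pos by (simp add: power_add[symmetric] algebra_simps)
  also have "\<dots> = 1" by (simp add: power_mult zeta_power_self modulus_pos)
  finally have "cnj (zeta c ^ a) * zeta c ^ a * zeta c ^ ((c - 1) * a) = cnj (zeta c ^ a)"
    by (simp add: mult.assoc)
  moreover have "zeta c ^ a * cnj (zeta c ^ a) = 1"
    by (simp add: complex_norm_square[symmetric] norm_power del: complex_cnj_power)
  ultimately show ?thesis by (metis mult.commute mult_1)
qed

text \<open>The real part averages \<open>zeta c ^ (b * n)\<close> and its conjugate. Conjugation
  replaces \<open>n\<close> by \<open>(c - 1) * n\<close>, which leaves the Gauss sum unchanged
  because \<open>chi\<close> is even.\<close>

lemma sum_chi_Re_zeta:
  "(\<Sum>b\<in>units c. chi b * of_real (Re (zeta c ^ (b * n)))) = cnj (chi n) * gauss 1"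
proof -
  have "complex_of_real (Re z) = (z + cnj z) / 2" for z
    by (simp add: complex_eq_iff)
  then have "(\<Sum>b\<in>units c. chi b * of_real (Re (zeta c ^ (b * n)))) =
      (\<Sum>b\<in>units c. (chi b * zeta c ^ (b * n) + chi b * zeta c ^ (b * ((c - 1) * n))) / 2)"
    unfolding cnj_zeta_power by (intro sum.cong refl) (simp add: cnj_zeta_power field_simps mult.left_commute del: complex_cnj_power)
  also have "\<dots> = (gauss n + gauss ((c - 1) * n)) / 2"
    by (simp add: gauss_def sum.distrib sum_divide_distrib[symmetric])
  also have "\<dots> = gauss n"
    using gauss_shift[OF chi_minus_1(2), of n] chi_minus_1(1) by simp
  finally show ?thesis unfolding gauss_eq[of n] .
qed

text \<open>Full periods sum to 0, so fewer than \<open>c\<close> terms of norm at most 1 remain;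
  the index shift only drops \<open>chi 0 = 0\<close>. Abel's theorem takes this bound as its
  hypothesis.\<close>

lemma norm_sum_chi_le: "cmod (\<Sum>k<N. chi (Suc k)) \<le> real c + 1"
proof -
  have 0: "(\<Sum>k<c. chi k) = 0"
    using sum_chi_eq_0 by (subst sum.mono_neutral_right[of _ "units c"]) (auto simp: chi_eq_0_iff)
  have "(\<Sum>k<N. chi k) = (\<Sum>k<N mod c. chi k)" for N
  proof -
    have shift: "(\<Sum>k = m * c..<m * c + s. chi k) = (\<Sum>k<s. chi k)" for m s
    proof -
      have "(\<Sum>k = m * c..<m * c + s. chi k) = (\<Sum>k = 0..<s. chi (k + m * c))"
        using sum.shift_bounds_nat_ivl[of chi 0 "m * c" s] by (simp add: add.commute)
      also have "\<dots> = (\<Sum>k = 0..<s. chi k)"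
        by (intro sum.cong refl chi_cong) (simp add: cong_def)
      finally show ?thesis by (simp add: lessThan_atLeast0)
    qed
    have "(\<Sum>k<q * c + r. chi k) = (\<Sum>k<r. chi k)" for q r
    proof -
      have "(\<Sum>k<q * c + r. chi k) = (\<Sum>k<q * c. chi k) + (\<Sum>k = q * c..<q * c + r. chi k)"
        by (simp add: lessThan_atLeast0 sum.atLeastLessThan_concat)
      also have "(\<Sum>k<q * c. chi k) = (\<Sum>m<q. \<Sum>k = m * c..<m * c + c. chi k)"
        by (simp add: sum.nat_group)
      finally show ?thesis unfolding shift 0 by simp
    qed
    then show ?thesis by (metis div_mult_mod_eq)
  qed
  moreover have "cmod (\<Sum>k<r. chi k) \<le> real r" for r
  proof -
    have "cmod (chi k) \<le> 1" for k
      using norm_chi[of k] chi_eq_0_iff[of k] by (cases "coprime k c") auto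
    then show ?thesis using sum_norm_le[of "{..<r}" chi "\<lambda>_. 1"] by simp
  qed
  ultimately have "cmod (\<Sum>k<Suc N. chi k) \<le> real c"
    by (metis less_imp_le mod_less_divisor modulus_pos of_nat_le_iff order.trans)
  moreover have "(\<Sum>k<Suc N. chi k) = chi 0 + (\<Sum>k<N. chi (Suc k))"
    by (rule sum.lessThan_Suc_shift)
  moreover have "chi 0 = 0" using modulus_gt_1 by (simp add: chi_eq_0_iff)
  ultimately show ?thesis by simp
qed

text \<open>Take real parts in the power series of \<open>ln (1 - z)\<close> at
  \<open>z = r * zeta c ^ b\<close>, which lies in the unit disc as \<open>r < 1\<close>. Summing
  over \<open>b\<close> against \<open>chi\<close> turns the coefficients into Gauss sums.\<close>

lemma sum_chi_ln_series:
  assumes "0 \<le> r" "r < 1"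
  shows "(\<Sum>b\<in>units c. chi b * of_real (ln (cmod (1 - of_real r * zeta c ^ b)))) =
    - gauss 1 * (\<Sum>k. cnj (chi (Suc k)) * of_real (r ^ Suc k / real (Suc k)))"
proof -
  \<comment> \<open>\<open>t 0 = 0\<close> since division by 0 yields 0; hence the later index shift
    loses nothing.\<close>
  define t where "t = (\<lambda>n. cnj (chi n) * complex_of_real (r ^ n / real n))"
  have "(\<lambda>n. complex_of_real (- (r ^ n / real n) * Re (zeta c ^ (b * n))))
      sums of_real (ln (cmod (1 - of_real r * zeta c ^ b)))" for b
  proof -
    have less: "cmod (of_real r * zeta c ^ b) < 1"
      using assms by (simp add: norm_mult norm_power)
    then have nz: "1 - of_real r * zeta c ^ b \<noteq> 0" by force
    have "(\<lambda>n. - ((of_real r * zeta c ^ b) ^ n) / of_nat n) sums ln (1 - of_real r * zeta c ^ b)"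
      using Ln_series'[of "- (of_real r * zeta c ^ b)"] less by simp
    then have "(\<lambda>n. Re (- ((of_real r * zeta c ^ b) ^ n) / of_nat n)) sums
        ln (cmod (1 - of_real r * zeta c ^ b))"
      using nz by (metis Re_Ln sums_Re)
    moreover have "Re (- ((of_real r * zeta c ^ b) ^ n) / of_nat n) =
        - (r ^ n / real n) * Re (zeta c ^ (b * n))" for n
      by (simp add: power_mult_distrib power_mult[symmetric] of_real_power[symmetric] del: of_real_power)
    ultimately show ?thesis by (simp only: sums_of_real)
  qed
  then have "(\<lambda>n. \<Sum>b\<in>units c. chi b * complex_of_real (- (r ^ n / real n) * Re (zeta c ^ (b * n))))
      sums (\<Sum>b\<in>units c. chi b * of_real (ln (cmod (1 - of_real r * zeta c ^ b))))"
    by (intro sums_sum sums_mult)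
  also have "(\<lambda>n. \<Sum>b\<in>units c. chi b * complex_of_real (- (r ^ n / real n) * Re (zeta c ^ (b * n)))) =
      (\<lambda>n. - gauss 1 * t n)"
  proof
    fix n
    have "(\<Sum>b\<in>units c. chi b * complex_of_real (- (r ^ n / real n) * Re (zeta c ^ (b * n)))) =
        - of_real (r ^ n / real n) * (\<Sum>b\<in>units c. chi b * of_real (Re (zeta c ^ (b * n))))"
      unfolding sum_distrib_left by (intro sum.cong refl) simp
    then show "(\<Sum>b\<in>units c. chi b * complex_of_real (- (r ^ n / real n) * Re (zeta c ^ (b * n)))) =
        - gauss 1 * t n"
      unfolding sum_chi_Re_zeta t_def by (simp add: mult_ac)
  qed
  finally have sums: "(\<lambda>n. - gauss 1 * t n) sums
      (\<Sum>b\<in>units c. chi b * of_real (ln (cmod (1 - of_real r * zeta c ^ b))))" .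
  have "gauss 1 \<noteq> 0" using norm_gauss modulus_pos by auto
  then have "summable t"
    using sums_summable[OF sums] summable_mult_D[of "- gauss 1" t] by simp
  then have "(\<Sum>n. - gauss 1 * t n) = - gauss 1 * (\<Sum>n. t (Suc n))"
    using suminf_split_head[of t] suminf_mult[of t "- gauss 1"] by (simp add: t_def)
  then show ?thesis using sums by (simp add: sums_iff t_def)
qed

text \<open>Let \<open>r\<close> tend to 1 from below in the series identity: the series converges
  by Abel's theorem, and the logarithms form a finite sum continuous at 1. \<open>L1\<close> appears
  conjugated because \<open>gauss n\<close> carries \<open>cnj (chi n)\<close>.\<close>

theorem sum_chi_ln_zeta:
  "(\<Sum>b\<in>units c. chi b * of_real (ln (cmod (zeta c ^ b - 1)))) = - gauss 1 * cnj (L1 chi)"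
proof -
  let ?S = "\<lambda>r. \<Sum>b\<in>units c. chi b * of_real (ln (cmod (1 - of_real r * zeta c ^ b)))"
  have bound: "cmod (\<Sum>k<N. cnj (chi (Suc k))) \<le> real c + 1" for N
    using norm_sum_chi_le[of N] by (metis cnj_sum complex_mod_cnj)
  note abel = abel_harmonic[OF norm_sum_chi_le] abel_harmonic[OF bound]
  have "(\<Sum>k. cnj (chi (Suc k)) / of_nat (Suc k)) = cnj (L1 chi)"
  proof -
    have "(\<lambda>k. cnj (chi (Suc k) / of_nat (Suc k))) sums cnj (L1 chi)"
      unfolding sums_cnj L1_def by (rule summable_sums[OF abel(1)])
    then show ?thesis by (simp add: sums_iff)
  qed
  then have "((\<lambda>r. - gauss 1 * (\<Sum>k. cnj (chi (Suc k)) * of_real (r ^ Suc k / real (Suc k)))) \<longlongrightarrow>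
      - gauss 1 * cnj (L1 chi)) (at_left 1)"
    using abel(4) by (intro tendsto_intros) simp
  moreover have "\<forall>\<^sub>F r in at_left (1::real).
      - gauss 1 * (\<Sum>k. cnj (chi (Suc k)) * of_real (r ^ Suc k / real (Suc k))) = ?S r"
    by (intro eventually_mono[OF eventually_at_left_real[of 0 1]])
       (simp_all add: sum_chi_ln_series del: of_nat_Suc of_real_divide power_Suc)
  ultimately have "(?S \<longlongrightarrow> - gauss 1 * cnj (L1 chi)) (at_left 1)"
    by (rule Lim_transform_eventually)
  moreover have "(?S \<longlongrightarrow> ?S 1) (at_left 1)"
  proof (intro tendsto_intros)
    \<comment> \<open>Continuity of \<open>ln\<close> needs \<open>zeta c ^ b \<noteq> 1\<close>,
      which holds since \<open>c > 1\<close> cannot divide a unit.\<close>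
    fix b assume "b \<in> units c"
    then have "\<not> c dvd b" using modulus_gt_1
      by (metis (no_types, lifting) coprime_absorb_right mem_Collect_eq nat_dvd_1_iff_1 nat_neq_iff)
    then show "cmod (1 - complex_of_real 1 * zeta c ^ b) \<noteq> 0"
      using zeta_power_eq_1_iff[OF modulus_pos, of b] by auto
  qed
  ultimately have "?S 1 = - gauss 1 * cnj (L1 chi)"
    by (intro tendsto_unique[of "at_left (1::real)"]) auto
  then show ?thesis by (simp add: norm_minus_commute)
qed

end

section \<open>The distribution relation\<close>

text \<open>The exponents \<open>b + k * n\<close> are the lifts of \<open>b\<close> modulo
  \<open>p * n\<close>, and \<open>zeta (p * n) ^ (b + k * n)\<close> is
  \<open>zeta p ^ k * w\<close> with \<open>w ^ p = zeta n ^ b\<close>. Applying \<open>ln\<close>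
  to the product formula for \<open>1 - w ^ p\<close> gives the sum.\<close>

lemma sum_ln_zeta_fibre:
  assumes "p > 0" "n > 1" "coprime b n"
  shows "(\<Sum>k<p. ln (cmod (zeta (p * n) ^ (b + k * n) - 1))) = ln (cmod (zeta n ^ b - 1))"
proof -
  define w where "w = zeta (p * n) ^ b"
  have "zeta (p * n) ^ (b + k * n) = zeta p ^ k * w" for k
    using assms zeta_mult_power[of n p]
    by (simp add: w_def power_add power_mult mult.commute[of p] mult.commute[of k])
  then have factor: "cmod (zeta (p * n) ^ (b + k * n) - 1) = cmod (1 - zeta p ^ k * w)" for k
    by (simp add: norm_minus_commute)
  have "w ^ p = (zeta (p * n) ^ p) ^ b" by (simp add: w_def power_mult[symmetric] mult.commute)
  also have "\<dots> = zeta n ^ b" using zeta_mult_power[of p n] assms by simp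
  finally have wp: "w ^ p = zeta n ^ b" .
  \<comment> \<open>This makes \<open>w ^ p \<noteq> 1\<close>, so no factor vanishes and
    \<open>ln\<close> of the product splits.\<close>
  have "\<not> n dvd b" using assms(2,3) by (metis coprime_absorb_right nat_dvd_1_iff_1 nat_neq_iff)
  then have "1 - w ^ p \<noteq> 0" using assms(2) zeta_power_eq_1_iff[of n b] by (simp add: wp)
  then have "(\<Prod>k<p. 1 - zeta p ^ k * w) \<noteq> 0" using prod_one_minus_zeta[OF assms(1)] by simp
  then have "cmod (1 - zeta p ^ k * w) \<noteq> 0" if "k < p" for k
    using that by auto
  then have "(\<Sum>k<p. ln (cmod (1 - zeta p ^ k * w))) = ln (\<Prod>k<p. cmod (1 - zeta p ^ k * w))"
    by (intro ln_prod[symmetric]) auto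
  also have "\<dots> = ln (cmod (1 - w ^ p))"
    using prod_one_minus_zeta[OF assms(1), of w] by (simp add: prod_norm)
  finally show ?thesis unfolding factor wp by (simp add: norm_minus_commute)
qed

context dchar
begin

text \<open>This is T(n). The character keeps its modulus \<open>c\<close> while \<open>n\<close>
  varies over multiples of \<open>c\<close>.\<close>

definition log_sum :: "nat \<Rightarrow> complex" where
  "log_sum n = (\<Sum>a\<in>units n. chi a * of_real (ln (cmod (zeta n ^ a - 1))))"

text \<open>Cutting the range into blocks of length \<open>n\<close> and swapping sums groups it by
  residue modulo \<open>n\<close>; \<open>chi\<close> is constant on each residue class as
  \<open>c\<close> divides \<open>n\<close>. The sum asks for coprimality to \<open>n\<close>, not
  to \<open>p * n\<close>; the next two lemmas settle the difference.\<close>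

lemma log_sum_fibres:
  assumes "c dvd n" "n > 1" "p > 0"
  shows "(\<Sum>x | x < p * n \<and> coprime x n. chi x * of_real (ln (cmod (zeta (p * n) ^ x - 1)))) =
    log_sum n"
proof -
  define h where "h = (\<lambda>x. chi x * of_real (ln (cmod (zeta (p * n) ^ x - 1))))"
  define h' where "h' = (\<lambda>x. if coprime x n then h x else 0)"
  have "(\<Sum>x | x < p * n \<and> coprime x n. h x) = (\<Sum>x<p * n. h' x)"
    unfolding h'_def by (subst sum.inter_filter[symmetric]) (auto intro: sum.cong)
  also have "\<dots> = (\<Sum>k<p. \<Sum>x = k * n..<k * n + n. h' x)"
    by (simp add: sum.nat_group)
  also have "\<dots> = (\<Sum>k<p. \<Sum>b<n. h' (b + k * n))"
  proof (rule sum.cong[OF refl])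
    fix k
    show "(\<Sum>x = k * n..<k * n + n. h' x) = (\<Sum>b<n. h' (b + k * n))"
      using sum.shift_bounds_nat_ivl[of h' 0 "k * n" n]
      by (simp add: lessThan_atLeast0 add.commute)
  qed
  also have "\<dots> = (\<Sum>b<n. \<Sum>k<p. h' (b + k * n))"
    by (rule sum.swap)
  also have "\<dots> = (\<Sum>b<n. if coprime b n then chi b * of_real (ln (cmod (zeta n ^ b - 1))) else 0)"
  proof (intro sum.cong refl)
    fix b
    have cong: "[b + k * n = b] (mod n)" for k by (simp add: cong_def)
    then have cop: "coprime (b + k * n) n \<longleftrightarrow> coprime b n" for k
      by (meson cong_imp_coprime cong_sym)
    have "chi (b + k * n) = chi b" for k
      using cong_dvd_modulus_nat[OF cong assms(1)] by (rule chi_cong)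
    then have "(\<Sum>k<p. h' (b + k * n)) = (if coprime b n then
        chi b * of_real (\<Sum>k<p. ln (cmod (zeta (p * n) ^ (b + k * n) - 1))) else 0)"
      by (simp add: h'_def h_def cop sum_distrib_left)
    also have "\<dots> = (if coprime b n then chi b * of_real (ln (cmod (zeta n ^ b - 1))) else 0)"
      using sum_ln_zeta_fibre[OF assms(3,2)] by (simp del: of_real_sum)
    finally show "(\<Sum>k<p. h' (b + k * n)) =
        (if coprime b n then chi b * of_real (ln (cmod (zeta n ^ b - 1))) else 0)" .
  qed
  also have "\<dots> = log_sum n"
    unfolding log_sum_def by (subst sum.inter_filter[symmetric]) (auto intro: sum.cong)
  finally show ?thesis unfolding h_def .
qed

lemma log_sum_mult_prime_dvd:
  assumes "c dvd n" "n > 1" "prime p" "p dvd n"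
  shows "log_sum (p * n) = log_sum n"
proof -
  have "coprime x (p * n) \<longleftrightarrow> coprime x n" for x
    using assms(4) by (auto simp: coprime_mult_right_iff elim: coprime_divisors[rotated 2])
  then show ?thesis
    using log_sum_fibres[OF assms(1,2), of p] assms(3) by (simp add: log_sum_def prime_gt_0_nat)
qed

text \<open>In the range, the numbers prime to \<open>n\<close> but not to \<open>p * n\<close> are
  the \<open>p * y\<close> with \<open>y\<close> a unit modulo \<open>n\<close>. As
  \<open>zeta (p * n) ^ p = zeta n\<close>, they contribute
  \<open>chi p * log_sum n\<close>.\<close>

lemma log_sum_mult_prime_not_dvd:
  assumes "c dvd n" "n > 1" "prime p" "\<not> p dvd n"
  shows "log_sum (p * n) = (1 - chi p) * log_sum n"
proof -
  define h where "h = (\<lambda>x. chi x * of_real (ln (cmod (zeta (p * n) ^ x - 1))))"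
  have p: "p > 0" "coprime p n" using assms(3,4) by (auto simp: prime_gt_0_nat prime_imp_coprime)
  have split: "{x. x < p * n \<and> coprime x n} = units (p * n) \<union> (\<lambda>y. p * y) ` units n"
  proof (intro equalityI subsetI)
    fix x assume x: "x \<in> {x. x < p * n \<and> coprime x n}"
    show "x \<in> units (p * n) \<union> (\<lambda>y. p * y) ` units n"
    proof (cases "p dvd x")
      case True
      then obtain y where "x = p * y" by blast
      then show ?thesis using x p by auto
    next
      case False
      then have "coprime x p" using assms(3) by (metis coprime_commute prime_imp_coprime)
      then show ?thesis using x by simp
    qed
  qed (use p in auto)
  have disj: "units (p * n) \<inter> (\<lambda>y. p * y) ` units n = {}"
    using assms(3) by (auto simp: not_prime_unit)
  have "log_sum n = (\<Sum>x | x < p * n \<and> coprime x n. h x)"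
    using log_sum_fibres[OF assms(1,2) p(1)] by (simp add: h_def)
  also have "\<dots> = log_sum (p * n) + (\<Sum>x\<in>(\<lambda>y. p * y) ` units n. h x)"
    unfolding split using disj by (subst sum.union_disjoint) (auto simp: log_sum_def h_def)
  also have "(\<Sum>x\<in>(\<lambda>y. p * y) ` units n. h x) = (\<Sum>y\<in>units n. h (p * y))"
    using p by (subst sum.reindex) (auto simp: inj_on_def)
  also have "\<dots> = chi p * log_sum n"
    using zeta_mult_power[of p n] p assms(2)
    by (simp add: h_def log_sum_def sum_distrib_left chi_mult power_mult mult.assoc)
  finally show ?thesis unfolding left_diff_distrib mult_1 by (metis eq_diff_eq)
qed

text \<open>Induction over the prime factors of \<open>m\<close>: a repeated prime adds nothing, a
  new one adds its Euler factor. Primes dividing \<open>c\<close> may stay in the product because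
  \<open>chi p = 0\<close> there.\<close>

lemma log_sum_eq_prod:
  assumes "c > 1" "m > 0"
  shows "log_sum (c * m) = (\<Prod>p\<in>prime_factors (c * m). 1 - chi p) * log_sum c"
  using assms(2)
proof (induction m rule: prime_divisors_induct)
  case (unit m)
  have "chi p = 0" if "p \<in> prime_factors c" for p
    using that by (auto simp: chi_eq_0_iff in_prime_factors_iff coprime_absorb_left prime_nat_iff)
  then show ?case using unit by simp
next
  case (factor p m)
  then have m: "m > 0" "p > 0" "prime p" by (auto intro: Nat.gr0I prime_gt_0_nat)
  define n where "n = c * m"
  have "c \<le> n" using m(1) by (simp add: n_def)
  then have n: "c dvd n" "n > 1" "n \<noteq> 0" using assms(1) by (auto simp only: n_def dvd_triv_left)
  have IH: "log_sum n = (\<Prod>p\<in>prime_factors n. 1 - chi p) * log_sum c"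
    using factor.IH m(1) by (simp add: n_def)
  have pf: "prime_factors (p * n) = insert p (prime_factors n)"
    using m n by (simp add: prime_factors_product prime_prime_factors)
  have "log_sum (p * n) = (\<Prod>p\<in>prime_factors (p * n). 1 - chi p) * log_sum c"
  proof (cases "p dvd n")
    case True
    then have "p \<in> prime_factors n" using m n by (simp add: in_prime_factors_iff)
    then show ?thesis using log_sum_mult_prime_dvd[OF n(1,2) m(3) True] IH by (simp add: pf insert_absorb)
  next
    case False
    then have "p \<notin> prime_factors n" by (simp add: in_prime_factors_iff)
    then show ?thesis using log_sum_mult_prime_not_dvd[OF n(1,2) m(3) False] IH by (simp add: pf mult.assoc)
  qed
  then show ?case by (simp add: n_def mult.left_commute)
qed simp

end

text \<open>By the Chinese remainder theorem each unit modulo \<open>g\<close> has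
  \<open>totient e\<close> lifts to units modulo \<open>e * g\<close>.\<close>

lemma sum_units_mod:
  fixes H :: "nat \<Rightarrow> complex"
  assumes "coprime e g" "e > 0" "g > 1"
  shows "(\<Sum>a\<in>units (e * g). H (a mod g)) = of_nat (totient e) * (\<Sum>a\<in>units g. H a)"
proof (cases "e = 1")
  case False
  then have e: "e > 1" using assms(2) by simp
  have eg: "e * g > 1" using e assms(3) by (rule less_1_mult)
  have "(\<Sum>a\<in>totatives (e * g). H (a mod g)) = (\<Sum>(x, y)\<in>totatives e \<times> totatives g. H y)"
    using sum.reindex_bij_betw[OF bij_betw_totatives[OF e assms(3,1)], of "\<lambda>(x, y). H y"] by simp
  also have "\<dots> = of_nat (totient e) * (\<Sum>a\<in>totatives g. H a)"
    by (simp add: sum.cartesian_product[symmetric] totient_def)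
  finally show ?thesis unfolding units_eq_totatives[OF eg] units_eq_totatives[OF assms(3)] .
qed auto

section \<open>Conductors and primitive characters\<close>

text \<open>The witness is \<open>n + m * t\<close> with \<open>t\<close> the product of the primes
  of \<open>f\<close> not dividing \<open>n\<close>: each prime of \<open>f\<close> then divides
  exactly one of the two summands.\<close>

lemma coprime_lift:
  fixes n m f :: nat
  assumes "coprime n m" "f > 0"
  shows "\<exists>x. coprime x f \<and> [x = n] (mod m)"
proof -
  define t where "t = \<Prod>{p \<in> prime_factors f. \<not> p dvd n}"
  have fin: "finite {p \<in> prime_factors f. \<not> p dvd n}" by simp
  have "coprime (n + m * t) f"
  proof (rule ccontr)
    assume "\<not> coprime (n + m * t) f"
    then have "gcd (n + m * t) f \<noteq> 1" unfolding coprime_iff_gcd_eq_1 .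
    then obtain p where "prime p" "p dvd gcd (n + m * t) f" using prime_factor_nat by blast
    then have p: "prime p" "p dvd n + m * t" "p dvd f" by simp_all
    show False
    proof (cases "p dvd n")
      case True
      then have "p dvd m * t" using p(2) by (simp add: dvd_add_right_iff)
      then have "p dvd m \<or> p dvd t" using p(1) by (simp add: prime_dvd_mult_iff)
      moreover have "\<not> p dvd m"
        using True assms(1) p(1) by (metis coprime_common_divisor_nat not_prime_1)
      moreover have "\<not> p dvd t"
      proof
        assume "p dvd t"
        then obtain q where "q \<in> prime_factors f" "\<not> q dvd n" "p dvd q"
          unfolding t_def using prime_dvd_prod_iff[OF fin p(1), of "\<lambda>x. x"] by auto
        then show False using True p(1) by (metis in_prime_factors_iff primes_dvd_imp_eq)
      qed
      ultimately show False by blast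
    next
      case False
      then have "p dvd t"
        unfolding t_def using p assms(2) by (intro dvd_prodI[OF fin, of _ "\<lambda>x. x", simplified]) (auto simp: in_prime_factors_iff)
      then have "p dvd m * t" by simp
      then show False using False p(2) by (simp add: dvd_add_left_iff)
    qed
  qed
  then show ?thesis by (intro exI[of _ "n + m * t"]) (simp add: cong_def)
qed

section \<open>Induced moduli and the conductor\<close>

context dchar
begin

text \<open>Multiplying by an inverse of \<open>b\<close> modulo \<open>c\<close> reduces to residue
  1, the case that the definition covers.\<close>

lemma induced_chi_eq:
  assumes "induced_modulus c chi d" "coprime a c" "coprime b c" "[a = b] (mod d)"
  shows "chi a = chi b"
proof -
  obtain b' where b': "[b * b' = 1] (mod c)"
    using cong_solve_coprime_nat[OF assms(3)] by auto
  then have cop: "coprime b' c"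
    by (metis coprime_mult_left_iff cong_imp_coprime cong_sym coprime_1_left)
  have d: "d dvd c" using assms(1) by (simp add: induced_modulus_def)
  have "[a * b' = b * b'] (mod d)" using assms(4) by (rule cong_scalar_right)
  also have "[b * b' = 1] (mod d)" using b' d by (rule cong_dvd_modulus_nat)
  finally have "chi (a * b') = 1"
    using assms(1,2) cop by (simp add: induced_modulus_def)
  moreover have "chi (b * b') = 1" using chi_cong[OF b'] chi_1 by simp
  ultimately have "chi a * chi b' = chi b * chi b'" by (simp add: chi_mult)
  then show ?thesis using cop chi_eq_0_iff by auto
qed

text \<open>If \<open>a\<close> is 1 modulo the gcd, some number is 1 modulo \<open>d1\<close> and
  \<open>a\<close> modulo \<open>d2\<close>. Lifted to a unit \<open>y\<close> modulo
  \<open>c\<close>, it gives \<open>chi a = chi y = 1\<close>. This closure upgrades minimality of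
  the conductor to divisibility.\<close>

lemma induced_gcd:
  assumes "induced_modulus c chi d1" "induced_modulus c chi d2"
  shows "induced_modulus c chi (gcd d1 d2)"
  unfolding induced_modulus_def
proof (intro conjI allI impI)
  have dvd: "d1 dvd c" "d2 dvd c" using assms by (simp_all add: induced_modulus_def)
  then show "gcd d1 d2 dvd c" by (meson dvd_trans gcd_dvd1)
  fix a assume a: "coprime a c \<and> [a = 1] (mod gcd d1 d2)"
  show "chi a = 1"
  \<comment> \<open>0 is set apart because the other case works with \<open>a - 1\<close>, which
    truncates at 0.\<close>
  proof (cases "a = 0")
    case True
    then have "c = 1" using a by simp
    then show ?thesis using chi_cong[of a 1] chi_1 by simp
  next
    case False
    have "gcd d1 d2 dvd a - 1" using a by (intro cong_to_1_nat) auto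
    then obtain k where "a - 1 = gcd d1 d2 * k" by blast
    then have k: "a = 1 + gcd d1 d2 * k" using False by simp
    have "d1 \<noteq> 0" using dvd modulus_pos by auto
    \<comment> \<open>Bezout without subtraction, as naturals require. It makes \<open>x\<close>
      congruent to 1 modulo \<open>d1\<close> and to \<open>a\<close> modulo
      \<open>d2\<close>.\<close>
    then obtain s t where st: "d1 * s = d2 * t + gcd d1 d2" using bezout_nat by blast
    define x where "x = 1 + d1 * s * k"
    have x: "x = a + d2 * t * k" unfolding x_def st k by (simp add: algebra_simps)
    have x1: "[x = 1] (mod d1)" unfolding x_def cong_def mult.assoc by (rule mod_mult_self2)
    have x2: "[x = a] (mod d2)" unfolding x cong_def mult.assoc by (rule mod_mult_self2)
    have "coprime x d1" using x1 by (metis cong_imp_coprime cong_sym coprime_1_left)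
    moreover have "coprime x d2"
      using x2 a dvd(2) by (metis cong_imp_coprime cong_sym coprime_divisors dvd_refl)
    ultimately have "coprime x (lcm d1 d2)"
      by (intro coprime_divisors[OF dvd_refl, of "lcm d1 d2" "d1 * d2"]) (simp_all add: lcm_least)
    then obtain y where y: "coprime y c" "[y = x] (mod lcm d1 d2)"
      using coprime_lift modulus_pos by blast
    have "[y = x] (mod d1)" "[y = x] (mod d2)" using y(2) by (auto elim: cong_dvd_modulus_nat)
    then have "[y = 1] (mod d1)" "[y = a] (mod d2)" using x1 x2 cong_trans by blast+
    then show ?thesis
      using induced_chi_eq[OF assms(2) y(1)] a assms(1) y(1) by (simp add: induced_modulus_def)
  qed
qed

lemma conductor_induced: "conductor c chi > 0" "induced_modulus c chi (conductor c chi)"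
proof -
  have "c > 0 \<and> induced_modulus c chi c"
    using modulus_pos chi_cong chi_1 by (auto simp: induced_modulus_def)
  from LeastI[of "\<lambda>d. d > 0 \<and> induced_modulus c chi d", OF this]
  show "conductor c chi > 0" "induced_modulus c chi (conductor c chi)"
    unfolding conductor_def by auto
qed

lemma conductor_le: "d > 0 \<Longrightarrow> induced_modulus c chi d \<Longrightarrow> conductor c chi \<le> d"
  unfolding conductor_def by (rule Least_le) simp

lemma conductor_dvd_modulus: "conductor c chi dvd c"
  using conductor_induced(2) by (simp add: induced_modulus_def)

text \<open>The gcd of the conductor with \<open>d\<close> is again an induced modulus, so it cannot
  be smaller than the conductor.\<close>

lemma conductor_dvd:
  assumes "induced_modulus c chi d"
  shows "conductor c chi dvd d"
proof -
  have "conductor c chi \<le> gcd (conductor c chi) d"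
    using induced_gcd[OF conductor_induced(2) assms] conductor_induced(1) by (intro conductor_le) auto
  then show ?thesis
    by (metis conductor_induced(1) dvd_imp_le gcd_dvd1 gcd_dvd2 le_antisym)
qed

text \<open>The choice made in \<open>prim_char\<close> is immaterial: two lifts prime to
  \<open>c\<close> agree modulo the conductor, itself an induced modulus, so \<open>chi\<close>
  agrees on them.\<close>

lemma prim_char_eq:
  assumes "coprime m c" "[m = n] (mod conductor c chi)"
  shows "prim_char c chi n = chi m"
proof -
  have "coprime m (conductor c chi)"
    using assms(1) conductor_dvd_modulus by (metis coprime_divisors dvd_refl)
  then have cop: "coprime n (conductor c chi)" using assms(2) by (rule cong_imp_coprime[rotated])
  define k where "k = (SOME k. coprime k c \<and> [k = n] (mod conductor c chi))"
  have k: "coprime k c \<and> [k = n] (mod conductor c chi)"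
    unfolding k_def by (rule someI[of _ m]) (use assms in simp)
  have "chi k = chi m"
    using k assms by (intro induced_chi_eq[OF conductor_induced(2)]) (auto intro: cong_trans cong_sym)
  then show ?thesis using cop by (simp add: prim_char_def k_def Let_def)
qed

lemma prim_char_of_coprime: "coprime n c \<Longrightarrow> prim_char c chi n = chi n"
  by (rule prim_char_eq) auto

lemma prim_char_lift:
  assumes "coprime n (conductor c chi)"
  obtains m where "coprime m c" "[m = n] (mod conductor c chi)"
  using coprime_lift[OF assms modulus_pos] by blast

lemma dirichlet_char_prim_char: "dirichlet_char (conductor c chi) (prim_char c chi)"
proof -
  let ?d = "conductor c chi" and ?psi = "prim_char c chi"
  have zero: "?psi n \<noteq> 0 \<longleftrightarrow> coprime n ?d" for n
  proof (cases "coprime n ?d")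
    case True
    then show ?thesis using prim_char_lift[OF True] prim_char_eq chi_eq_0_iff by metis
  qed (simp add: prim_char_def)
  have cong: "?psi a = ?psi b" if ab: "[a = b] (mod ?d)" for a b
  proof (cases "coprime b ?d")
    case True
    then obtain m where m: "coprime m c" "[m = b] (mod ?d)" by (rule prim_char_lift)
    then have "[m = a] (mod ?d)" using ab cong_trans cong_sym by blast
    then show ?thesis using prim_char_eq m by metis
  next
    case False
    then have "\<not> coprime a ?d" using ab cong_imp_coprime by blast
    then show ?thesis using False zero by metis
  qed
  have mult: "?psi (m * n) = ?psi m * ?psi n" for m n
  proof (cases "coprime m ?d \<and> coprime n ?d")
    case True
    then obtain x y where x: "coprime x c" "[x = m] (mod ?d)" and y: "coprime y c" "[y = n] (mod ?d)"
      using prim_char_lift by metis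
    then have "?psi (m * n) = chi (x * y)" by (intro prim_char_eq cong_mult) auto
    then show ?thesis using prim_char_eq[OF x] prim_char_eq[OF y] by (simp add: chi_mult)
  next
    case False
    then have "\<not> coprime (m * n) ?d" by simp
    then show ?thesis using False zero by (metis mult_zero_left mult_zero_right)
  qed
  have "?psi 1 = 1" using prim_char_of_coprime[of 1] chi_1 by simp
  then show ?thesis
    unfolding dirichlet_char_def using zero mult conductor_induced(1)
    by (auto intro!: cong simp: cong_def)
qed

lemma primitive_even_char_prim_char:
  assumes "even_char c chi" "conductor c chi > 1"
  shows "primitive_even_char (conductor c chi) (prim_char c chi)"
proof
  let ?d = "conductor c chi"
  show "dirichlet_char ?d (prim_char c chi)" by (rule dirichlet_char_prim_char)
  show "?d > 1" by (rule assms(2))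
  have chi: "chi (c - 1) = 1" using assms(1) by (simp add: even_char_def)
  \<comment> \<open>Both numbers represent -1 modulo the conductor, so evenness passes to the
    primitive character.\<close>
  have "[c - 1 = ?d - 1] (mod ?d)"
  proof -
    obtain k where k: "c = ?d * k" using conductor_dvd_modulus by blast
    then have "k > 0" using modulus_pos by (intro Nat.gr0I) auto
    then obtain j where "k = Suc j" using gr0_implies_Suc by blast
    then have "c - 1 = ?d - 1 + ?d * j" using k assms(2) by simp
    then show ?thesis by (simp add: cong_def)
  qed
  moreover have "coprime (c - 1) c" using chi chi_eq_0_iff[of "c - 1"] by fastforce
  ultimately show "even_char ?d (prim_char c chi)"
    unfolding even_char_def using prim_char_eq chi by metis
  fix d assume d: "d dvd ?d" "d < ?d"
  then have "d > 0" "d dvd c"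
    using assms(2) conductor_dvd_modulus by (auto intro: Nat.gr0I dvd_trans)
  \<comment> \<open>A proper divisor lies below the least induced modulus. The resulting witness is
    prime to \<open>c\<close>, where both characters agree.\<close>
  moreover have "\<not> induced_modulus c chi d"
    using conductor_le[OF \<open>d > 0\<close>] d(2) by auto
  ultimately obtain a where a: "coprime a c" "[a = 1] (mod d)" "chi a \<noteq> 1"
    unfolding induced_modulus_def by blast
  moreover have "coprime a ?d"
    using a(1) conductor_dvd_modulus by (metis coprime_divisors dvd_refl)
  ultimately show "\<exists>a. coprime a ?d \<and> [a = 1] (mod d) \<and> prim_char c chi a \<noteq> 1"
    using prim_char_of_coprime by auto
qed

end

section \<open>The logarithm vector\<close>

text \<open>The cofactor is the product over the complementary set of primes; full prime powers on
  each side make the two coprime.\<close>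

lemma Qset_decompose:
  assumes "f > 0" "e \<in> Qset f"
  obtains g where "f = e * g" "coprime e g" "e > 0" "g > 0"
proof -
  obtain S where S: "S \<subseteq> prime_factors f" "e = (\<Prod>p\<in>S. p ^ multiplicity p f)"
    using assms(2) by (auto simp: Qset_def)
  define g where "g = (\<Prod>p\<in>prime_factors f - S. p ^ multiplicity p f)"
  have "f = (\<Prod>p\<in>prime_factors f. p ^ multiplicity p f)"
    using assms(1) by (rule prime_factorization_nat)
  also have "\<dots> = e * g"
    unfolding g_def S(2) using S(1) by (subst prod.subset_diff[of S]) (auto simp: mult.commute)
  finally have f: "f = e * g" .
  have "coprime (p ^ i) (q ^ j)" if "p \<in> S" "q \<in> prime_factors f - S" for p q i j
    using that S(1) by (intro coprime_power_left_iff[THEN iffD2] disjI1 coprime_power_right_iff[THEN iffD2] primes_coprime) (auto simp: in_prime_factors_iff)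
  then have "coprime e g"
    unfolding g_def S(2) by (intro prod_coprime_left prod_coprime_right)
  moreover have "e > 0" "g > 0" using f assms(1) by (auto intro: Nat.gr0I)
  ultimately show ?thesis using f that by blast
qed

lemma sigma_monom_minus_1: "sigma f a (Polynomial.monom 1 e - 1) = (zeta f ^ e) ^ a - 1"
proof -
  have "map_poly (of_rat :: rat \<Rightarrow> complex) (Polynomial.monom 1 e - 1) = Polynomial.monom 1 e - 1"
    by (rule poly_eqI) (simp add: coeff_map_poly of_rat_diff coeff_1)
  then show ?thesis
    by (simp add: sigma_def poly_monom power_mult[symmetric] mult.commute)
qed

text \<open>For \<open>f > 2\<close> a class consists of exactly two units, and by the symmetry of
  \<open>h\<close> it does not matter which one \<open>rep\<close> picks.\<close>

lemma double_sum_Gf: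
  fixes h :: "nat \<Rightarrow> complex"
  assumes "f > 2" "\<And>a. a \<in> units f \<Longrightarrow> h (f - a) = h a"
  shows "2 * (\<Sum>C\<in>Gf f. h (rep C)) = (\<Sum>a\<in>units f. h a)"
proof -
  define cl where "cl = (\<lambda>a. {a, (f - a) mod f})"
  have cl: "cl a = {a, f - a}" "f - a \<in> units f" "a \<noteq> f - a" if a: "a \<in> units f" for a
  proof -
    have "a \<noteq> 0" using a assms(1) by (cases "a = 0") auto
    then show "cl a = {a, f - a}" using a by (simp add: cl_def)
    show "f - a \<in> units f"
      using a \<open>a \<noteq> 0\<close> gcd_diff2_nat[of a f] by (simp only: coprime_iff_gcd_eq_1) auto
    show "a \<noteq> f - a"
    proof
      assume "a = f - a"
      then have "f = 2 * a" using a by simp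
      \<comment> \<open>\<open>a\<close> divides \<open>f\<close> and is prime to it.\<close>
      then have "a = 1" using a by (metis (mono_tags) coprime_absorb_left dvd_triv_right mem_Collect_eq nat_dvd_1_iff_1)
      then show False using \<open>f = 2 * a\<close> assms(1) by simp
    qed
  qed
  have "(\<Sum>a\<in>units f. h a) = (\<Sum>C\<in>cl ` units f. \<Sum>a | a \<in> units f \<and> cl a = C. h a)"
    by (rule sum.image_gen) simp
  also have "\<dots> = (\<Sum>C\<in>cl ` units f. 2 * h (rep C))"
  proof (intro sum.cong refl)
    fix C assume "C \<in> cl ` units f"
    then obtain a where a: "a \<in> units f" "C = cl a" by blast
    have "{x. x \<in> units f \<and> cl x = C} = {a, f - a}"
    proof (intro equalityI subsetI)
      fix x assume "x \<in> {x. x \<in> units f \<and> cl x = C}"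
      then show "x \<in> {a, f - a}" using a cl(1) by blast
    next
      fix x assume "x \<in> {a, f - a}"
      then show "x \<in> {x. x \<in> units f \<and> cl x = C}"
        using a cl(1,2)[OF a(1)] cl(1)[OF cl(2)[OF a(1)]] by auto
    qed
    then have "(\<Sum>a | a \<in> units f \<and> cl a = C. h a) = h a + h (f - a)"
      using cl(3)[OF a(1)] by simp
    moreover have "rep C \<in> {a, f - a}"
      unfolding rep_def a(2) cl(1)[OF a(1)] by (rule someI[of _ a]) simp
    ultimately show "(\<Sum>a | a \<in> units f \<and> cl a = C. h a) = 2 * h (rep C)"
      using assms(2)[OF a(1)] by auto
  qed
  finally show ?thesis by (simp add: sum_distrib_left Gf_def cl_def)
qed

text \<open>In the denominator, 2 comes from passing from classes to units and \<open>ln 2\<close>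
  from the binary logarithm.\<close>

lemma (in dchar) char_ext_Log_vec:
  assumes "even_char c chi" "c > 2" "c = e * g" "e > 0" "g > 1"
  shows "char_ext c chi (Log_vec c (Polynomial.monom (1::rat) e - 1)) =
    (\<Sum>a\<in>units c. chi a * of_real (ln (cmod (zeta g ^ a - 1)))) / of_real (2 * ln 2)"
proof -
  define h where "h = (\<lambda>a. of_real (log 2 (cmod (zeta g ^ a - 1))) * chi a)"
  have z: "zeta c ^ e = zeta g" using zeta_mult_power[of e g] assms by simp
  have even: "h (c - a) = h a" if "a \<in> units c" for a
  proof -
    have sum: "a + (c - a) = c" using that by simp
    have "zeta g ^ (c - a) * zeta g ^ a = zeta g ^ c"
      using sum by (metis power_add mult.commute)
    also have "\<dots> = 1" using assms zeta_power_eq_1_iff[of g c] by simp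
    finally have inv: "zeta g ^ (c - a) * zeta g ^ a = 1" .
    \<comment> \<open>Multiplying by \<open>zeta g ^ a\<close>, of norm 1, turns the term for
      \<open>-a\<close> into that for \<open>a\<close> up to sign.\<close>
    have "cmod (zeta g ^ (c - a) - 1) = cmod ((zeta g ^ (c - a) - 1) * zeta g ^ a)"
      by (simp add: norm_mult norm_power)
    also have "(zeta g ^ (c - a) - 1) * zeta g ^ a = 1 - zeta g ^ a"
      using inv by (simp add: left_diff_distrib)
    finally have 1: "cmod (zeta g ^ (c - a) - 1) = cmod (zeta g ^ a - 1)"
      by (simp add: norm_minus_commute)
    have "[(c - 1) * a + a = (c - a) + a] (mod c)"
      using sum assms(2) by (simp add: cong_def algebra_simps)
    then have "[c - a = (c - 1) * a] (mod c)" by (metis cong_add_rcancel_nat cong_sym)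
    then have "chi (c - a) = chi ((c - 1) * a)" by (rule chi_cong)
    then have 2: "chi (c - a) = chi a" using assms(1) by (simp add: chi_mult even_char_def)
    show ?thesis unfolding h_def 1 2 ..
  qed
  have "2 * char_ext c chi (Log_vec c (Polynomial.monom (1::rat) e - 1)) = (\<Sum>a\<in>units c. h a)"
    using double_sum_Gf[of c h, OF assms(2) even]
    by (simp add: char_ext_def Log_vec_def sigma_monom_minus_1 z h_def)
  also have "\<dots> = (\<Sum>a\<in>units c. chi a * of_real (ln (cmod (zeta g ^ a - 1)))) / of_real (ln 2)"
    by (simp add: h_def log_def sum_divide_distrib mult.commute)
  finally show ?thesis by (simp add: field_simps)
qed

theorem theorem19:
  fixes f e :: nat and chi :: "nat \<Rightarrow> complex"
  assumes "f > 0"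
    and "e \<in> Qset f" and "e \<noteq> f"
    and "dirichlet_char f chi" and "even_char f chi"
    and "conductor f chi > 1"
  shows "(coprime (conductor f chi) e \<longrightarrow>
           cmod (char_ext f chi (Log_vec f (Polynomial.monom (1::rat) e - 1))) =
             real (totient e) * sqrt (real (conductor f chi)) / (2 * ln 2) *
             (\<Prod>p\<in>{p \<in> prime_factors f. p dvd f div e}. cmod (1 - prim_char f chi p)) *
             cmod (L1 (prim_char f chi)))
       \<and> (\<not> coprime (conductor f chi) e \<longrightarrow>
           char_ext f chi (Log_vec f (Polynomial.monom (1::rat) e - 1)) = 0)"
proof -
  interpret dchar f chi by unfold_locales (rule assms(4))
  define c where "c = conductor f chi"
  define psi where "psi = prim_char f chi"
  interpret prim: primitive_even_char c psi
    unfolding c_def psi_def by (rule primitive_even_char_prim_char[OF assms(5,6)])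
  obtain g where g: "f = e * g" "coprime e g" "e > 0" "g > 0"
    using Qset_decompose[OF assms(1,2)] .
  have "g > 1" using g assms(3) by (cases "g = 1") auto
  have c: "c dvd f" unfolding c_def by (rule conductor_dvd_modulus)
  \<comment> \<open>Conductor 2 is impossible: all units modulo 2 are congruent to 1, which
    contradicts primitivity at the divisor 1.\<close>
  have "f > 2"
  proof -
    have "c \<noteq> 2"
      using prim.primitive[of 1] prim.chi_cong[of _ 1] prim.chi_1
      by (auto simp: cong_def odd_iff_mod_2_eq_one)
    then show ?thesis using c prim.modulus_gt_1 assms(1) by (auto dest!: dvd_imp_le)
  qed
  define L where "L a = complex_of_real (ln (cmod (zeta g ^ a - 1)))" for a
  note ext = char_ext_Log_vec[OF assms(5) \<open>f > 2\<close> g(1,3) \<open>g > 1\<close>, folded L_def]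
  show ?thesis unfolding c_def[symmetric] psi_def[symmetric]
  proof (intro conjI impI)
    assume cop: "coprime c e"
    then have "c dvd g" using c g(1) by (simp add: coprime_dvd_mult_right_iff)
    then obtain m where m: "g = c * m" by blast
    then have "m > 0" using g(4) by (intro Nat.gr0I) auto
    \<comment> \<open>On units modulo \<open>f\<close> the characters \<open>chi\<close> and
      \<open>psi\<close> agree; since \<open>c\<close> divides \<open>g\<close>, the summand then
      depends only on \<open>a mod g\<close>.\<close>
    have "(\<Sum>a\<in>units f. chi a * L a) = (\<Sum>a\<in>units (e * g). psi (a mod g) * L (a mod g))"
    proof (rule sum.cong)
      fix a assume "a \<in> units (e * g)"
      then have "chi a = psi a" using g(1) prim_char_of_coprime by (simp add: psi_def)
      also have "psi a = psi (a mod g)"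
        by (rule prim.chi_cong) (use \<open>c dvd g\<close> in \<open>simp add: cong_def mod_mod_cancel\<close>)
      moreover have "L a = L (a mod g)"
        unfolding L_def using g(4) zeta_power_cong[of g a "a mod g"] by (simp add: cong_def)
      ultimately show "chi a * L a = psi (a mod g) * L (a mod g)" by simp
    qed (simp add: g(1))
    also have "\<dots> = of_nat (totient e) * prim.log_sum g"
      unfolding prim.log_sum_def L_def[symmetric]
      by (rule sum_units_mod[OF g(2,3) \<open>g > 1\<close>, of "\<lambda>a. psi a * L a"])
    also have "prim.log_sum g = (\<Prod>p\<in>prime_factors g. 1 - psi p) * (- prim.gauss 1 * cnj (L1 psi))"
      unfolding m prim.log_sum_eq_prod[OF prim.modulus_gt_1 \<open>m > 0\<close>]
      by (simp add: prim.log_sum_def prim.sum_chi_ln_zeta)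
    finally have eq: "char_ext f chi (Log_vec f (Polynomial.monom (1::rat) e - 1)) =
        of_nat (totient e) * ((\<Prod>p\<in>prime_factors g. 1 - psi p) * (- prim.gauss 1 * cnj (L1 psi))) /
          of_real (2 * ln 2)"
      unfolding ext by simp
    have "{p \<in> prime_factors f. p dvd f div e} = prime_factors g"
      using g by (auto simp: in_prime_factors_iff)
    then show "cmod (char_ext f chi (Log_vec f (Polynomial.monom (1::rat) e - 1))) =
        real (totient e) * sqrt (real c) / (2 * ln 2) *
        (\<Prod>p\<in>{p \<in> prime_factors f. p dvd f div e}. cmod (1 - psi p)) * cmod (L1 psi)"
      unfolding eq
      by (simp add: norm_mult norm_divide prod_norm[symmetric] prim.norm_gauss[unfolded One_nat_def])
  next
    assume ncop: "\<not> coprime c e"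
    \<comment> \<open>If \<open>c\<close> divided \<open>g\<close>, coprimality of \<open>e\<close>
      and \<open>g\<close> would make \<open>c\<close> prime to \<open>e\<close>.\<close>
    have "\<not> c dvd g"
      using ncop g(2) by (metis coprime_commute coprime_divisors dvd_refl)
    then have "\<not> induced_modulus f chi g"
      using conductor_dvd by (auto simp: c_def)
    \<comment> \<open>Multiplication by \<open>u\<close> leaves every \<open>L a\<close> unchanged,
      so the sum equals \<open>chi u\<close> times itself and vanishes.\<close>
    then obtain u where u: "coprime u f" "[u = 1] (mod g)" "chi u \<noteq> 1"
      unfolding induced_modulus_def using g(1) by auto
    have "L (a mod f) = L a" for a
      unfolding L_def using g zeta_power_cong[of g "a mod f" a] by (simp add: cong_def mod_mod_cancel)
    then have "(\<Sum>a\<in>units f. chi a * L a) = chi u * (\<Sum>a\<in>units f. chi a * L (a * u))"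
      by (rule sum_units_chi_mult[OF u(1)])
    moreover have "L (a * u) = L a" for a
      unfolding L_def using g(4) cong_scalar_left[OF u(2), of a] zeta_power_cong[of g "a * u" a] by simp
    ultimately have "(1 - chi u) * (\<Sum>a\<in>units f. chi a * L a) = 0"
      by (simp add: algebra_simps)
    then have "(\<Sum>a\<in>units f. chi a * L a) = 0" using u(3) by simp
    then show "char_ext f chi (Log_vec f (Polynomial.monom (1::rat) e - 1)) = 0"
      unfolding ext by simp
  qed
qed

end
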